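(* Let $n\ge 2$ and $a\ge 2\sqrt{n-1}$, and let $f(x)=a|x^{(1)}|+\sum_{i=2}^n x^{(i)}$ on $\mathbb{R}^n$. If scaled memoryless BFGS is applied to $f$ from a starting point $x_0$ with $x_0^{(1)}\neq 0$, using an Armijo-Wolfe line search that satisfies $t_k\le 2$ for all $k\ge 1$ (such as the Armijo-Wolfe bracketing line search), then the method fails in the sense that $f(x_N)$ is bounded below as $N\to\infty$.
   Context: Superscript $(i)$ denotes the $i$-th component of a vector. The function $f$ is differentiable exactly at points with $x^{(1)}\neq 0$. Fix parameters $0<c_1<c_2<1$ (the Armijo and Wolfe parameters). Given $x$ at which $f$ is differentiable and a direction $d$ with $\nabla f(x)^Td<0$, a steplength $t>0$ satisfies the Armijo condition if $f(x+td)\le f(x)+c_1t\nabla f(x)^Td$, and the Wolfe condition if $\nabla f(x+td)$ exists and $\nabla f(x+td)^Td\ge c_2\nabla f(x)^Td$. An Armijo-Wolfe line search is any rule returning some $t$ satisfying both conditions. Scaled memoryless BFGS (with input $x_0$): set $d_0=-\nabla f(x_0)$. For $k=1,2,3,\dots$: let $t_{k-1}$ be a steplength satisfying the Armijo and Wolfe conditions at $x_{k-1}$ along $d_{k-1}$ (if none exists, terminate); set $x_k=x_{k-1}+t_{k-1}d_{k-1}$, $s_{k-1}=x_k-x_{k-1}$, $y_{k-1}=\nabla f(x_k)-\nabla f(x_{k-1})$, $V_{k-1}=I-\dfrac{y_{k-1}s_{k-1}^T}{y_{k-1}^Ts_{k-1}}$, $H_k=\dfrac{s_{k-1}^Ty_{k-1}}{y_{k-1}^Ty_{k-1}}V_{k-1}^TV_{k-1}+\dfrac{s_{k-1}s_{k-1}^T}{s_{k-1}^Ty_{k-1}}$,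 and $d_k=-H_k\nabla f(x_k)$. Armijo-Wolfe bracketing line search: start with $\alpha=0$, $\beta=+\infty$, $t=1$. Repeat: if the Armijo condition fails at $t$, set $\beta\leftarrow t$; else if the Wolfe condition fails at $t$, set $\alpha\leftarrow t$; else stop and return $t$. Then, if $\beta<+\infty$ set $t\leftarrow(\alpha+\beta)/2$, otherwise set $t\leftarrow 2\alpha$. *)

theory Defs
  imports "HOL-Analysis.Analysis"
begin

text \<open>The coordinates of \<open>\<real>\<^sup>n\<close> are indexed by an unordered finite type;
  the index \<open>i1\<close> plays the role of the first coordinate.\<close>

definition ns_fun :: "real \<Rightarrow> 'n::finite \<Rightarrow> real^'n \<Rightarrow> real" where
  "ns_fun a i1 x = a * \<bar>x $ i1\<bar> + (\<Sum>i\<in>UNIV - {i1}. x $ i)"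

text \<open>Only meaningful at points of differentiability.\<close>

definition grad :: "(real^'n \<Rightarrow> real) \<Rightarrow> real^'n \<Rightarrow> real^'n" where
  "grad f x = (THE g. GDERIV f x :> g)"

definition armijo :: "(real^'n \<Rightarrow> real) \<Rightarrow> real \<Rightarrow> real^'n \<Rightarrow> real^'n \<Rightarrow> real \<Rightarrow> bool" where
  "armijo f c1 x d t \<longleftrightarrow> f (x + t *\<^sub>R d) \<le> f x + c1 * t * (grad f x \<bullet> d)"

definition wolfe :: "(real^'n \<Rightarrow> real) \<Rightarrow> real \<Rightarrow> real^'n \<Rightarrow> real^'n \<Rightarrow> real \<Rightarrow> bool" where
  "wolfe f c2 x d t \<longleftrightarrow>
     f differentiable (at (x + t *\<^sub>R d)) \<and> grad f (x + t *\<^sub>R d) \<bullet> d \<ge> c2 * (grad f x \<bullet> d)"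

text \<open>The first two conjuncts are the standing conditions under which Armijo and Wolfe
  steplengths are defined.\<close>

definition armijo_wolfe ::
  "(real^'n \<Rightarrow> real) \<Rightarrow> real \<Rightarrow> real \<Rightarrow> real^'n \<Rightarrow> real^'n \<Rightarrow> real \<Rightarrow> bool" where
  "armijo_wolfe f c1 c2 x d t \<longleftrightarrow>
     f differentiable (at x) \<and> grad f x \<bullet> d < 0 \<and>
     t > 0 \<and> armijo f c1 x d t \<and> wolfe f c2 x d t"

definition outer_product :: "real^'n \<Rightarrow> real^'n \<Rightarrow> real^'n^'n" where
  "outer_product u v = (\<chi> i j. u $ i * v $ j)"

text \<open>The memoryless BFGS matrix \<open>H\<close>, scaled, for a step \<open>s\<close> and a gradient difference \<open>y\<close>.\<close>

definition smbfgs_matrix :: "real^'n \<Rightarrow> real^'n \<Rightarrow> real^'n^'n" where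
  "smbfgs_matrix s y =
     (let V = mat 1 - (1 / (y \<bullet> s)) *\<^sub>R outer_product y s
      in ((s \<bullet> y) / (y \<bullet> y)) *\<^sub>R (transpose V ** V) + (1 / (s \<bullet> y)) *\<^sub>R outer_product s s)"

text \<open>A line search is a relation: \<open>L x d t\<close> means that \<open>t\<close> may be returned at \<open>x\<close> along \<open>d\<close>.
  The run has iterates \<open>x k\<close> and directions \<open>d k\<close> for \<open>k \<le> K\<close> and steplengths \<open>t k\<close> for
  \<open>k < K\<close>; other values of the three sequences are irrelevant. A run is maximal: it is finite
  only if \<open>L\<close> returns nothing at the last iterate. Any history-dependent rule that picks a
  steplength allowed by \<open>L\<close> whenever there is one also produces such a run.\<close>

definition smbfgs_run ::
  "(real^'n \<Rightarrow> real^'n \<Rightarrow> real \<Rightarrow> bool) \<Rightarrow> (real^'n \<Rightarrow> real) \<Rightarrow> real^'n \<Rightarrow> enat \<Rightarrow>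
   (nat \<Rightarrow> real^'n) \<Rightarrow> (nat \<Rightarrow> real^'n) \<Rightarrow> (nat \<Rightarrow> real) \<Rightarrow> bool" where
  "smbfgs_run L f x0 K x d t \<longleftrightarrow>
     x 0 = x0 \<and> d 0 = - grad f x0 \<and>
     (\<forall>k. enat k < K \<longrightarrow>
        L (x k) (d k) (t k) \<and>
        x (Suc k) = x k + t k *\<^sub>R d k \<and>
        d (Suc k) = - (smbfgs_matrix (x (Suc k) - x k) (grad f (x (Suc k)) - grad f (x k))
                        *v grad f (x (Suc k)))) \<and>
     (\<forall>m. K = enat m \<longrightarrow> (\<nexists>\<tau>. L (x m) (d m) \<tau>))"

definition next_trial :: "real \<Rightarrow> ereal \<Rightarrow> real" where
  "next_trial \<alpha> \<beta> = (if \<beta> < \<infinity> then (\<alpha> + real_of_ereal \<beta>) / 2 else 2 * \<alpha>)"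

text \<open>\<open>bracketing f c1 c2 x d \<alpha> \<beta> t \<tau>\<close>: started in the state \<open>(\<alpha>, \<beta>, t)\<close>, the loop stops
  after finitely many iterations and returns \<open>\<tau>\<close>.\<close>

inductive bracketing ::
  "(real^'n \<Rightarrow> real) \<Rightarrow> real \<Rightarrow> real \<Rightarrow> real^'n \<Rightarrow> real^'n \<Rightarrow>
   real \<Rightarrow> ereal \<Rightarrow> real \<Rightarrow> real \<Rightarrow> bool"
  for f c1 c2 x d where
  armijo_fails:
    "\<lbrakk>\<not> armijo f c1 x d t;
      bracketing f c1 c2 x d \<alpha> (ereal t) (next_trial \<alpha> (ereal t)) \<tau>\<rbrakk>
     \<Longrightarrow> bracketing f c1 c2 x d \<alpha> \<beta> t \<tau>"
| wolfe_fails: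
    "\<lbrakk>armijo f c1 x d t; \<not> wolfe f c2 x d t;
      bracketing f c1 c2 x d t \<beta> (next_trial t \<beta>) \<tau>\<rbrakk>
     \<Longrightarrow> bracketing f c1 c2 x d \<alpha> \<beta> t \<tau>"
| stop:
    "\<lbrakk>armijo f c1 x d t; wolfe f c2 x d t\<rbrakk> \<Longrightarrow> bracketing f c1 c2 x d \<alpha> \<beta> t t"

definition bracketing_search ::
  "(real^'n \<Rightarrow> real) \<Rightarrow> real \<Rightarrow> real \<Rightarrow> real^'n \<Rightarrow> real^'n \<Rightarrow> real \<Rightarrow> bool" where
  "bracketing_search f c1 c2 x d \<tau> \<longleftrightarrow> bracketing f c1 c2 x d 0 \<infinity> 1 \<tau>"

end

theory Submission
  imports Defs
begin

text \<open>A Wolfe step must change the sign of the first component, so \<open>y\<close> is a multiple of the first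
  unit vector and every direction has the form \<open>d = D (-\<sigma>, -q, \<dots>, -q)\<close> with \<open>\<sigma>\<close> the sign
  of \<open>x\<^sup>(\<^sup>1\<^sup>)\<close>. Writing \<open>m = n - 1\<close>, one step with steplength \<open>t\<close> gives
  \<open>q' = (1 - qa + 2mq\<^sup>2) / (a - qm)\<close> and \<open>2aD' = (a - qm) t D\<close>, and \<open>a\<^sup>2 \<ge> 4m\<close> keeps
  \<open>q\<close> in \<open>[0, 1/a]\<close>. As the step lowers the sum of the other components by exactly
  \<open>qm t D = a t D - 2aD'\<close>, that sum minus \<open>2aD\<close> does not decrease in a step with \<open>t \<le> 2\<close>,
  and it is a lower bound for \<open>f\<close>. For the bracketing search, the Armijo condition gives
  \<open>\<bar>x\<^sup>(\<^sup>1\<^sup>)\<bar> < 2D\<close> at every iterate after the first, so the trial \<open>t = 2\<close> already satisfies the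
  Wolfe condition.\<close>

section \<open>Vectors constant off the first coordinate, and the action of the BFGS matrix\<close>

text \<open>By symmetry in the other coordinates, all gradients and directions of a run lie in this
  two-dimensional space, so every vector identity reduces to two scalar ones.\<close>

definition axial_vec :: "'n \<Rightarrow> real \<Rightarrow> real \<Rightarrow> real^'n::finite" where
  "axial_vec i1 u v = (\<chi> i. if i = i1 then u else v)"

lemma axial_vec_nth [simp]: "axial_vec i1 u v $ i = (if i = i1 then u else v)"
  by (simp add: axial_vec_def)

lemma scaleR_axial_vec: "r *\<^sub>R axial_vec i1 u v = axial_vec i1 (r * u) (r * v)"
  by (simp add: vec_eq_iff)

lemma add_axial_vec: "axial_vec i1 u v + axial_vec i1 u' v' = axial_vec i1 (u + u') (v + v')"
  by (simp add: vec_eq_iff)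

lemma diff_axial_vec: "axial_vec i1 u v - axial_vec i1 u' v' = axial_vec i1 (u - u') (v - v')"
  by (simp add: vec_eq_iff)

lemma minus_axial_vec: "- axial_vec i1 u v = axial_vec i1 (- u) (- v)"
  by (simp add: vec_eq_iff)

lemmas axial_vec_arith = scaleR_axial_vec add_axial_vec diff_axial_vec minus_axial_vec

lemma inner_axial_vec:
  fixes i1 :: "'n::finite"
  shows "axial_vec i1 u v \<bullet> axial_vec i1 u' v' = u * u' + real (CARD('n) - 1) * (v * v')"
proof -
  have "axial_vec i1 u v \<bullet> axial_vec i1 u' v' = (\<Sum>i\<in>UNIV. axial_vec i1 u v $ i * axial_vec i1 u' v' $ i)"
    by (simp add: inner_vec_def)
  also have "\<dots> = u * u' + (\<Sum>i\<in>UNIV - {i1}. axial_vec i1 u v $ i * axial_vec i1 u' v' $ i)"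
    by (subst sum.remove[of _ i1]) auto
  also have "(\<Sum>i\<in>UNIV - {i1}. axial_vec i1 u v $ i * axial_vec i1 u' v' $ i) = (\<Sum>i\<in>UNIV - {i1}. v * v')"
    by (intro sum.cong) auto
  finally show ?thesis by simp
qed

lemma outer_product_mult_vec: "outer_product u v *v w = (v \<bullet> w) *\<^sub>R u"
  by (simp add: vec_eq_iff matrix_vector_mult_def outer_product_def inner_vec_def
      sum_distrib_left mult_ac)

text \<open>Both \<open>V\<close> and its transpose are rank-one perturbations of the identity.
  Applying them one after the other, with \<open>w\<close> for \<open>V *v g\<close>, leaves only
  inner products to compute.\<close>

lemma smbfgs_matrix_mult_vec:
  fixes s y g :: "real^'n"
  defines "w \<equiv> g - ((s \<bullet> g) / (y \<bullet> s)) *\<^sub>R y"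
  shows "smbfgs_matrix s y *v g =
    ((s \<bullet> y) / (y \<bullet> y)) *\<^sub>R (w - ((y \<bullet> w) / (y \<bullet> s)) *\<^sub>R s) + ((s \<bullet> g) / (s \<bullet> y)) *\<^sub>R s"
proof -
  define V where "V = mat 1 - (1 / (y \<bullet> s)) *\<^sub>R outer_product y s"
  have "transpose V = mat 1 - (1 / (y \<bullet> s)) *\<^sub>R outer_product s y"
    by (simp add: V_def vec_eq_iff transpose_def outer_product_def mat_def mult.commute)
  then have VT: "transpose V *v z = z - ((y \<bullet> z) / (y \<bullet> s)) *\<^sub>R s" for z
    by (simp add: matrix_vector_mult_diff_rdistrib scaleR_matrix_vector_assoc[symmetric]
        outer_product_mult_vec)
  have V: "V *v g = w"
    by (simp add: V_def w_def matrix_vector_mult_diff_rdistrib scaleR_matrix_vector_assoc[symmetric]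
        outer_product_mult_vec)
  have "smbfgs_matrix s y = ((s \<bullet> y) / (y \<bullet> y)) *\<^sub>R (transpose V ** V) + (1 / (s \<bullet> y)) *\<^sub>R outer_product s s"
    by (simp add: smbfgs_matrix_def V_def Let_def)
  then show ?thesis
    by (simp add: matrix_vector_mult_add_rdistrib scaleR_matrix_vector_assoc[symmetric]
        outer_product_mult_vec matrix_vector_mul_assoc[symmetric] V VT
        del: transpose_matrix_vector)
qed

section \<open>Gradient and differentiability of the objective\<close>

lemma grad_eqI:
  assumes "GDERIV f x :> g"
  shows "grad f x = g"
  unfolding grad_def
proof (rule the_equality, fact assms)
  fix h assume h: "GDERIV f x :> h"
  then have "(\<lambda>z. z \<bullet> h) = (\<lambda>z. z \<bullet> g)"
    using assms unfolding gderiv_def by (rule has_derivative_unique)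
  from fun_cong[OF this, of "h - g"] have "(h - g) \<bullet> (h - g) = 0"
    by (simp add: inner_diff_right)
  then show "h = g" by simp
qed

text \<open>Both \<open>\<bar>x\<bar>\<close> and \<open>\<bar>x\<bar> - x\<close> have a local
  minimum at 0, which would force \<open>D = 0\<close> and \<open>D = 1\<close>.\<close>

lemma not_has_real_derivative_abs_0: "\<not> (abs has_real_derivative D) (at (0::real))"
proof
  assume D: "(abs has_real_derivative D) (at (0::real))"
  have "D = 0"
    by (rule DERIV_local_min[OF D, of 1]) auto
  have "((\<lambda>x. \<bar>x\<bar> - x) has_real_derivative D - 1) (at 0)"
    by (intro derivative_intros D)
  then have "D - 1 = 0"
    by (rule DERIV_local_min[of _ _ _ 1]) auto
  with \<open>D = 0\<close> show False by simp
qed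

text \<open>On the line through \<open>x\<close> along the first axis the function is
  \<open>a * \<bar>t\<bar>\<close> plus a constant, and dividing by \<open>a\<close> would make the
  absolute value differentiable at 0.\<close>

lemma ns_fun_not_differentiable:
  fixes x :: "real^'n"
  assumes "x $ i1 = 0" "a > 0"
  shows "\<not> ns_fun a i1 differentiable (at x)"
proof
  assume "ns_fun a i1 differentiable (at x)"
  then have "(ns_fun a i1 \<circ> (\<lambda>t. x + t *\<^sub>R axial_vec i1 1 0)) differentiable (at (0::real))"
    by (intro differentiable_chain_at derivative_intros) auto
  moreover have "ns_fun a i1 \<circ> (\<lambda>t. x + t *\<^sub>R axial_vec i1 1 0) = (\<lambda>t. a * \<bar>t\<bar> + (\<Sum>i\<in>UNIV - {i1}. x $ i))"
    using assms by (auto simp: ns_fun_def fun_eq_iff intro!: sum.cong)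
  ultimately have "(\<lambda>t. a * \<bar>t\<bar> + (\<Sum>i\<in>UNIV - {i1}. x $ i)) differentiable (at 0)"
    by simp
  then obtain D where "((\<lambda>t. a * \<bar>t\<bar> + (\<Sum>i\<in>UNIV - {i1}. x $ i)) has_real_derivative D) (at 0)"
    by (auto simp: real_differentiable_def)
  from DERIV_cdivide[OF DERIV_diff[OF this DERIV_const[of "\<Sum>i\<in>UNIV - {i1}. x $ i"]], of a]
  have "(abs has_real_derivative (D - 0) / a) (at 0)"
    using assms by simp
  then show False by (simp add: not_has_real_derivative_abs_0 del: diff_zero)
qed

lemma GDERIV_ns_fun:
  fixes x :: "real^'n"
  assumes "x $ i1 \<noteq> 0"
  shows "GDERIV (ns_fun a i1) x :> axial_vec i1 (a * sgn (x $ i1)) 1"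
proof -
  have nth: "((\<lambda>x. x $ i) has_derivative (\<lambda>h. h $ i)) (at x)" for i
    by (rule bounded_linear_imp_has_derivative) (rule bounded_linear_vec_nth)
  have abs: "((\<lambda>x. \<bar>x $ i1\<bar>) has_derivative (\<lambda>h. h $ i1 * sgn (x $ i1))) (at x)"
    using has_derivative_compose[OF nth[of i1] has_derivative_norm[OF assms]] by simp
  have *: "((\<lambda>x. a * \<bar>x $ i1\<bar> + (\<Sum>i\<in>UNIV - {i1}. x $ i)) has_derivative
      (\<lambda>h. a * (h $ i1 * sgn (x $ i1)) + (\<Sum>i\<in>UNIV - {i1}. h $ i))) (at x)"
    by (intro derivative_intros nth abs)
  have "h \<bullet> axial_vec i1 (a * sgn (x $ i1)) 1 = a * (h $ i1 * sgn (x $ i1)) + (\<Sum>i\<in>UNIV - {i1}. h $ i)" for h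
    unfolding inner_vec_def by (subst sum.remove[of _ i1]) (auto intro!: sum.cong)
  with * show ?thesis
    by (simp add: gderiv_def ns_fun_def[abs_def])
qed

lemma grad_ns_fun: "x $ i1 \<noteq> 0 \<Longrightarrow> grad (ns_fun a i1) x = axial_vec i1 (a * sgn (x $ i1)) 1"
  by (rule grad_eqI[OF GDERIV_ns_fun])

lemma ns_fun_differentiable_iff:
  assumes "a > 0"
  shows "ns_fun a i1 differentiable (at x) \<longleftrightarrow> x $ i1 \<noteq> 0"
  using ns_fun_not_differentiable[OF _ assms, of x i1] GDERIV_ns_fun[of x i1 a]
  by (auto simp: gderiv_def differentiable_def)

section \<open>The bracketing search, with acceptable steps given as an interval\<close>

text \<open>A midpoint or a doubled lower end keeps the trial positive and inside the bracket, and
  the upper end never grows. Hence a trial rejected by Armijo bounds the result.\<close>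

lemma bracketing_bounds:
  assumes "bracketing f c1 c2 x d \<alpha> \<beta> t \<tau>" "0 \<le> \<alpha>" "\<alpha> \<le> t" "0 < t" "ereal t \<le> \<beta>"
  shows "0 < \<tau> \<and> ereal \<tau> \<le> \<beta>"
  using assms
proof induction
  case (armijo_fails t \<alpha> \<tau> \<beta>)
  then have "0 < \<tau> \<and> ereal \<tau> \<le> ereal t"
    by (auto simp: next_trial_def)
  with armijo_fails.prems show ?case
    using order_trans by blast
next
  case (wolfe_fails t \<beta> \<tau> \<alpha>)
  then show ?case
    by (cases \<beta>) (auto simp: next_trial_def)
qed auto

lemma bracketing_imp: "bracketing f c1 c2 x d \<alpha> \<beta> t \<tau> \<Longrightarrow> armijo f c1 x d \<tau> \<and> wolfe f c2 x d \<tau>"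
  by (induction rule: bracketing.induct) auto

text \<open>Each rejected trial halves the bracket, which still satisfies \<alpha> \<le>
  \<open>t1\<close> and \<open>T < b\<close> and so stays longer than \<open>T - t1\<close>. Thus
  \<open>n\<close> bounds the number of rejections, and \<open>n = 0\<close> is
  contradictory.\<close>

lemma bracketing_bisection:
  assumes armijo: "\<And>t. t > 0 \<Longrightarrow> armijo f c1 x d t \<longleftrightarrow> t \<le> T"
    and wolfe: "\<And>t. t > 0 \<Longrightarrow> wolfe f c2 x d t \<longleftrightarrow> t1 < t"
    and "t1 < T" "0 \<le> \<alpha>" "\<alpha> \<le> t1" "T < b" "b - \<alpha> < 2 ^ n * (T - t1)"
  shows "\<exists>\<tau>. bracketing f c1 c2 x d \<alpha> (ereal b) (next_trial \<alpha> (ereal b)) \<tau>"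
  using assms(3-)
proof (induction n arbitrary: \<alpha> b)
  case 0
  then show ?case by simp
next
  case (Suc n)
  define t where "t = next_trial \<alpha> (ereal b)"
  have t: "t = (\<alpha> + b) / 2" by (simp add: t_def next_trial_def)
  have "t > 0" using Suc.prems by (simp add: t)
  consider "t > T" | "t \<le> T" "t \<le> t1" | "t \<le> T" "t1 < t" by linarith
  then have "\<exists>\<tau>. bracketing f c1 c2 x d \<alpha> (ereal b) t \<tau>"
  proof cases
    case 1
    then have "t - \<alpha> < 2 ^ n * (T - t1)"
      using Suc.prems(5) by (simp add: t field_simps)
    then obtain \<tau> where "bracketing f c1 c2 x d \<alpha> (ereal t) (next_trial \<alpha> (ereal t)) \<tau>"
      using Suc.IH[of \<alpha> t] Suc.prems 1 by auto
    moreover have "\<not> armijo f c1 x d t" using armijo[OF \<open>t > 0\<close>] 1 by simp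
    ultimately show ?thesis by - (intro exI, rule bracketing.armijo_fails)
  next
    case 2
    then have "b - t < 2 ^ n * (T - t1)"
      using Suc.prems(5) by (simp add: t field_simps)
    then obtain \<tau> where "bracketing f c1 c2 x d t (ereal b) (next_trial t (ereal b)) \<tau>"
      using Suc.IH[of t b] Suc.prems 2 \<open>t > 0\<close> by auto
    moreover have "armijo f c1 x d t" "\<not> wolfe f c2 x d t"
      using armijo[OF \<open>t > 0\<close>] wolfe[OF \<open>t > 0\<close>] 2 by simp_all
    ultimately show ?thesis by - (intro exI, rule bracketing.wolfe_fails)
  next
    case 3
    with armijo[OF \<open>t > 0\<close>] wolfe[OF \<open>t > 0\<close>] show ?thesis
      by - (intro exI, rule bracketing.stop, simp_all)
  qed
  then show ?case by (simp add: t_def)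
qed

text \<open>While no upper end is known, trials double until one exceeds \<open>t1\<close>, with
  \<open>n\<close> bounding the number of doublings. That trial is either accepted or beyond
  \<open>T\<close>, in which case bisection takes over.\<close>

lemma bracketing_doubling:
  assumes armijo: "\<And>t. t > 0 \<Longrightarrow> armijo f c1 x d t \<longleftrightarrow> t \<le> T"
    and wolfe: "\<And>t. t > 0 \<Longrightarrow> wolfe f c2 x d t \<longleftrightarrow> t1 < t"
    and "t1 < T" "0 \<le> \<alpha>" "\<alpha> \<le> t1" "0 < t" "t1 < 2 ^ n * t"
  shows "\<exists>\<tau>. bracketing f c1 c2 x d \<alpha> \<infinity> t \<tau>"
proof -
  have fails: "\<exists>\<tau>. bracketing f c1 c2 x d \<alpha> \<infinity> t \<tau>" if "0 \<le> \<alpha>" "\<alpha> \<le> t1" "T < t" for \<alpha> t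
  proof -
    obtain n where "(t - \<alpha>) / (T - t1) < 2 ^ n"
      using real_arch_pow[of 2 "(t - \<alpha>) / (T - t1)"] by auto
    then have "t - \<alpha> < 2 ^ n * (T - t1)"
      using \<open>t1 < T\<close> by (simp add: field_simps)
    from bracketing_bisection[OF armijo wolfe \<open>t1 < T\<close> that this]
    obtain \<tau> where "bracketing f c1 c2 x d \<alpha> (ereal t) (next_trial \<alpha> (ereal t)) \<tau>" by blast
    moreover have "\<not> armijo f c1 x d t" using armijo[of t] that \<open>t1 < T\<close> by simp
    ultimately show ?thesis by - (intro exI, rule bracketing.armijo_fails)
  qed
  have stops: "\<exists>\<tau>. bracketing f c1 c2 x d \<alpha> \<infinity> t \<tau>" if "t > 0" "t1 < t" "t \<le> T" for \<alpha> t
    using that armijo[of t] wolfe[of t] by - (intro exI, rule bracketing.stop, simp_all)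
  show ?thesis
    using assms(4-)
  proof (induction n arbitrary: \<alpha> t)
    case 0
    then show ?case using fails[of \<alpha> t] stops[of t \<alpha>] by force
  next
    case (Suc n)
    show ?case
    proof (cases "t \<le> t1")
      case True
      then obtain \<tau> where "bracketing f c1 c2 x d t \<infinity> (2 * t) \<tau>"
        using Suc.IH[of t "2 * t"] Suc.prems by (auto simp: mult_ac)
      then have "bracketing f c1 c2 x d t \<infinity> (next_trial t \<infinity>) \<tau>"
        by (simp add: next_trial_def)
      moreover have "armijo f c1 x d t" "\<not> wolfe f c2 x d t"
        using armijo[of t] wolfe[of t] True Suc.prems \<open>t1 < T\<close> by auto
      ultimately show ?thesis by - (intro exI, rule bracketing.wolfe_fails)
    next
      case False
      then show ?thesis using fails[of \<alpha> t] stops[of t \<alpha>] Suc.prems by force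
    qed
  qed
qed

lemma bracketing_search_exists:
  assumes "\<And>t. t > 0 \<Longrightarrow> armijo f c1 x d t \<longleftrightarrow> t \<le> T"
    and "\<And>t. t > 0 \<Longrightarrow> wolfe f c2 x d t \<longleftrightarrow> t1 < t"
    and "0 \<le> t1" "t1 < T"
  shows "\<exists>\<tau>. bracketing_search f c1 c2 x d \<tau>"
proof -
  obtain n where "t1 < 2 ^ n"
    using real_arch_pow[of 2 t1] by auto
  with bracketing_doubling[OF assms(1,2,4), of 0 1 n] assms(3) show ?thesis
    by (auto simp: bracketing_search_def)
qed

text \<open>If the trial 1 does not already stop the search or become the upper end, the next trial
  is 2. As Wolfe holds there, either 2 is returned or Armijo makes it the upper end.\<close>

lemma bracketing_search_le_2:
  assumes "bracketing_search f c1 c2 x d \<tau>" "wolfe f c2 x d 2"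
  shows "\<tau> \<le> 2"
  using assms(1) unfolding bracketing_search_def
proof (cases rule: bracketing.cases)
  case armijo_fails
  then show ?thesis
    using bracketing_bounds[OF armijo_fails(2)] by (simp add: next_trial_def)
next
  case wolfe_fails
  then have "bracketing f c1 c2 x d 1 \<infinity> 2 \<tau>" by (simp add: next_trial_def)
  then show ?thesis
  proof (cases rule: bracketing.cases)
    case armijo_fails
    then show ?thesis
      using bracketing_bounds[OF armijo_fails(2)] by (simp add: next_trial_def)
  qed (use assms(2) in auto)
qed auto

section \<open>The form of the directions and the behaviour of the objective along them\<close>

locale smbfgs_ns =
  fixes a c1 c2 m :: real and i1 :: "'n::finite"
  assumes card: "m = real (CARD('n) - 1)" "m \<ge> 1"
    and c: "0 < c1" "c1 < c2" "c2 < 1"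
    and a: "a > 0" "a\<^sup>2 \<ge> 4 * m"
begin

abbreviation "f \<equiv> ns_fun a i1"
abbreviation "tail_sum x \<equiv> (\<Sum>i\<in>UNIV - {i1}. x $ i)"

text \<open>The invariant of a run. Steepest descent starts it with \<open>D = a\<close> at the end
  \<open>q = 1 / a\<close> of the range allowed for \<open>q\<close>.\<close>

definition state :: "real^'n \<Rightarrow> real^'n \<Rightarrow> real \<Rightarrow> real \<Rightarrow> bool" where
  "state x d D q \<longleftrightarrow> x $ i1 \<noteq> 0 \<and> 0 < D \<and> 0 \<le> q \<and> q * a \<le> 1 \<and>
     d = axial_vec i1 (- (sgn (x $ i1) * D)) (- (q * D))"

lemma inner: "axial_vec i1 u v \<bullet> axial_vec i1 u' v' = u * u' + m * (v * v')"
  by (simp add: inner_axial_vec card)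

lemma sgn_sq: "r \<noteq> 0 \<Longrightarrow> sgn r * sgn r = (1::real)"
  by (simp add: sgn_if)

text \<open>This is where the size of \<open>a\<close> enters: \<open>4 * m * q\<close> is at most
  \<open>a\<^sup>2 * q\<close>, hence at most \<open>a\<close>. It makes \<open>a - m * q\<close>
  positive, so the slope beyond the kink is positive too.\<close>

lemma q_bound: "0 \<le> q \<Longrightarrow> q * a \<le> 1 \<Longrightarrow> 4 * (m * q) \<le> a"
proof -
  assume q: "0 \<le> q" "q * a \<le> 1"
  have "4 * m * q \<le> a\<^sup>2 * q" using a q by (intro mult_right_mono) auto
  also have "\<dots> = a * (q * a)" by (simp add: power2_eq_square)
  also have "\<dots> \<le> a * 1" using a q by (intro mult_left_mono) auto
  finally show ?thesis by simp
qed

lemma state_step_nth: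
  assumes "state x d D q"
  shows "(x + t *\<^sub>R d) $ i1 = sgn (x $ i1) * (\<bar>x $ i1\<bar> - t * D)"
    and "tail_sum (x + t *\<^sub>R d) = tail_sum x - m * q * (t * D)"
proof -
  have d: "d = axial_vec i1 (- (sgn (x $ i1) * D)) (- (q * D))"
    using assms by (simp add: state_def)
  have "x $ i1 = sgn (x $ i1) * \<bar>x $ i1\<bar>" by (simp add: sgn_mult_abs)
  then show "(x + t *\<^sub>R d) $ i1 = sgn (x $ i1) * (\<bar>x $ i1\<bar> - t * D)"
    by (simp add: d algebra_simps)
  have "tail_sum (x + t *\<^sub>R d) = (\<Sum>i\<in>UNIV - {i1}. x $ i - t * q * D)"
    by (intro sum.cong) (auto simp: d)
  then show "tail_sum (x + t *\<^sub>R d) = tail_sum x - m * q * (t * D)"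
    by (simp add: sum_subtractf card algebra_simps)
qed

lemma state_grad_inner:
  assumes "state x d D q"
  shows "grad f x \<bullet> d = - (D * (a + m * q))"
    and "z $ i1 \<noteq> 0 \<Longrightarrow> sgn (z $ i1) = - sgn (x $ i1) \<Longrightarrow> grad f z \<bullet> d = D * (a - m * q)"
    and "grad f x \<bullet> d < 0"
proof -
  show *: "grad f x \<bullet> d = - (D * (a + m * q))"
    using assms sgn_sq[of "x $ i1"]
    by (simp add: state_def grad_ns_fun inner algebra_simps)
  have "D * (a + m * q) > 0"
    using assms a card by (intro mult_pos_pos add_pos_nonneg) (auto simp: state_def)
  with * show "grad f x \<bullet> d < 0" by simp
  show "z $ i1 \<noteq> 0 \<Longrightarrow> sgn (z $ i1) = - sgn (x $ i1) \<Longrightarrow> grad f z \<bullet> d = D * (a - m * q)"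
    using assms sgn_sq[of "x $ i1"]
    by (simp add: state_def grad_ns_fun inner algebra_simps)
qed

section \<open>Acceptable steplengths along a direction\<close>

text \<open>Along \<open>d\<close> the function is piecewise linear with its only kink where the
  first component vanishes. Before the kink the slope is the initial one, rejected because
  \<open>c2 < 1\<close>; at the kink there is no gradient; beyond it the slope is
  nonnegative.\<close>

lemma wolfe_iff:
  assumes st: "state x d D q" and "t > 0"
  shows "wolfe f c2 x d t \<longleftrightarrow> \<bar>x $ i1\<bar> < t * D"
proof -
  define z where "z = x + t *\<^sub>R d"
  have z: "z $ i1 = sgn (x $ i1) * (\<bar>x $ i1\<bar> - t * D)"
    using state_step_nth(1)[OF st] by (simp add: z_def)
  have x: "x $ i1 \<noteq> 0" "D > 0" "0 \<le> q" "q * a \<le> 1" using st by (auto simp: state_def)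
  have diff: "f differentiable (at z) \<longleftrightarrow> z $ i1 \<noteq> 0"
    by (rule ns_fun_differentiable_iff) (rule a)
  have c2: "c2 * (grad f x \<bullet> d) > grad f x \<bullet> d"
    using state_grad_inner(3)[OF st] c by simp
  consider "\<bar>x $ i1\<bar> < t * D" | "\<bar>x $ i1\<bar> = t * D" | "\<bar>x $ i1\<bar> > t * D" by linarith
  then show ?thesis
  proof cases
    case 1
    then have "sgn (z $ i1) = - sgn (x $ i1)" "z $ i1 \<noteq> 0"
      using x by (auto simp: z sgn_mult sgn_eq_0_iff)
    then have "grad f z \<bullet> d = D * (a - m * q)"
      using state_grad_inner(2)[OF st] by blast
    moreover have "D * (a - m * q) \<ge> 0"
      using q_bound[OF x(3,4)] x a by (intro mult_nonneg_nonneg) auto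
    moreover have "c2 * (grad f x \<bullet> d) \<le> 0"
      using state_grad_inner(3)[OF st] c by (simp add: mult_le_0_iff)
    ultimately show ?thesis using 1 \<open>z $ i1 \<noteq> 0\<close>
      by (simp add: wolfe_def z_def[symmetric] diff)
  next
    case 2
    then show ?thesis by (simp add: wolfe_def z_def[symmetric] diff z)
  next
    case 3
    then have "sgn (z $ i1) = sgn (x $ i1)" "z $ i1 \<noteq> 0"
      using x by (auto simp: z sgn_mult sgn_eq_0_iff)
    then have "grad f z = grad f x" using x by (simp add: grad_ns_fun)
    with 3 c2 show ?thesis by (simp add: wolfe_def z_def[symmetric])
  qed
qed

lemma armijo_eq:
  assumes st: "state x d D q"
  shows "armijo f c1 x d t \<longleftrightarrow>
    a * \<bar>\<bar>x $ i1\<bar> - t * D\<bar> - a * \<bar>x $ i1\<bar> - m * q * (t * D) \<le> - (c1 * (t * D) * (a + m * q))"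
proof -
  have "\<bar>sgn (x $ i1)\<bar> = 1" using st by (simp add: state_def sgn_if)
  then have "\<bar>(x + t *\<^sub>R d) $ i1\<bar> = \<bar>\<bar>x $ i1\<bar> - t * D\<bar>"
    unfolding state_step_nth[OF st] abs_mult by simp
  then show ?thesis
    unfolding armijo_def ns_fun_def state_step_nth(2)[OF st] state_grad_inner(1)[OF st]
    by (simp add: algebra_simps)
qed

lemma line_search_intervals:
  assumes st: "state x d D q"
  obtains t1 T where "0 < t1" "t1 < T"
    "\<And>t. t > 0 \<Longrightarrow> armijo f c1 x d t \<longleftrightarrow> t \<le> T"
    "\<And>t. t > 0 \<Longrightarrow> wolfe f c2 x d t \<longleftrightarrow> t1 < t"
proof -
  define p where "p = \<bar>x $ i1\<bar>"
  \<comment> \<open>Beyond the kink, where \<open>t * D \<ge> p\<close>, the Armijo condition is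
    linear and reads \<open>t * D * B \<le> 2 * a * p\<close>. From \<open>c1 < 1\<close> it follows
    that \<open>B < 2 * a\<close>, which puts \<open>T\<close> beyond the kink.\<close>
  define B where "B = a - m * q + c1 * (a + m * q)"
  have x: "p > 0" "D > 0" "0 \<le> q" "q * a \<le> 1" using st by (auto simp: state_def p_def)
  have mq: "0 \<le> m * q" "m * q < a" using q_bound[OF x(3,4)] x a card by auto
  have c1: "c1 * (a + m * q) > 0" "c1 * (a + m * q) < a + m * q"
    using c mq a by auto
  have B: "B > 0" "B < 2 * a" unfolding B_def using mq c1 by linarith+
  have "2 * a / B > 1" using B by simp
  txt \<open>The Armijo bound \<open>T\<close> solves \<open>a (S - p) - a p - m q S = - c1 S (a + m q)\<close> for \<open>S = T D\<close>.\<close>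
  show thesis
  proof (rule that[of "p / D" "p / D * (2 * a / B)"])
    show "0 < p / D" using x by simp
    from mult_strict_left_mono[OF \<open>2 * a / B > 1\<close> this] show "p / D < p / D * (2 * a / B)" by simp
    fix t :: real assume "t > 0"
    show "wolfe f c2 x d t \<longleftrightarrow> p / D < t"
      using wolfe_iff[OF st \<open>t > 0\<close>] x by (simp add: p_def field_simps)
    have "armijo f c1 x d t \<longleftrightarrow> t * D * B \<le> p * (2 * a)"
    proof (cases "p \<le> t * D")
      case True
      then show ?thesis by (simp add: armijo_eq[OF st] p_def[symmetric] B_def algebra_simps)
    next
      \<comment> \<open>Before the kink both sides hold: the decrease follows the full initial
        slope, and \<open>c1 < 1\<close>.\<close>
      case False
      then have "t * D * B \<le> p * (2 * a)" using B x \<open>t > 0\<close> by (intro mult_mono) auto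
      moreover have "c1 * (t * D) * (a + m * q) \<le> t * D * (a + m * q)"
        using c1 mult_left_mono[OF less_imp_le[OF c1(2)], of "t * D"] \<open>t > 0\<close> x by (simp add: mult_ac)
      then have "armijo f c1 x d t"
        using False by (simp add: armijo_eq[OF st] p_def[symmetric] algebra_simps)
      ultimately show ?thesis by simp
    qed
    then show "armijo f c1 x d t \<longleftrightarrow> t \<le> p / D * (2 * a / B)"
      using B x by (simp add: field_simps)
  qed
qed

lemma state_armijo_wolfe_iff:
  assumes "state x d D q"
  shows "armijo_wolfe f c1 c2 x d t \<longleftrightarrow> t > 0 \<and> armijo f c1 x d t \<and> wolfe f c2 x d t"
  using assms state_grad_inner(3)[OF assms] ns_fun_differentiable_iff[OF a(1)]
  by (auto simp: armijo_wolfe_def state_def)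

lemma armijo_wolfe_exists:
  assumes "state x d D q"
  shows "\<exists>t. armijo_wolfe f c1 c2 x d t"
proof -
  obtain t1 T where "0 < t1" "t1 < T"
    "\<And>t. t > 0 \<Longrightarrow> armijo f c1 x d t \<longleftrightarrow> t \<le> T"
    "\<And>t. t > 0 \<Longrightarrow> wolfe f c2 x d t \<longleftrightarrow> t1 < t"
    by (rule line_search_intervals[OF assms]) blast
  then show ?thesis
    by (auto simp: state_armijo_wolfe_iff[OF assms] intro!: exI[of _ T])
qed

lemma bracketing_exists:
  assumes "state x d D q"
  shows "\<exists>t. bracketing_search f c1 c2 x d t"
proof -
  obtain t1 T where t1: "0 < t1" "t1 < T"
    and "\<And>t. t > 0 \<Longrightarrow> armijo f c1 x d t \<longleftrightarrow> t \<le> T"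
    "\<And>t. t > 0 \<Longrightarrow> wolfe f c2 x d t \<longleftrightarrow> t1 < t"
    by (rule line_search_intervals[OF assms]) blast
  from bracketing_search_exists[OF this(3,4)] t1 show ?thesis by simp
qed

lemma bracketing_search_armijo_wolfe:
  assumes "state x d D q" "bracketing_search f c1 c2 x d t"
  shows "armijo_wolfe f c1 c2 x d t"
  using assms(2) bracketing_imp[of f c1 c2 x d 0 \<infinity> 1 t] bracketing_bounds[of f c1 c2 x d 0 \<infinity> 1 t]
  unfolding state_armijo_wolfe_iff[OF assms(1)] bracketing_search_def by auto

section \<open>The update of the direction\<close>

lemma state_init:
  assumes "x $ i1 \<noteq> 0"
  shows "state x (- grad f x) a (1 / a)"
  using assms a by (simp add: state_def grad_ns_fun minus_axial_vec mult.commute)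

text \<open>As \<open>y\<close> lies along the first axis, \<open>V\<close> changes only the first
  component of the new gradient, and \<open>transpose V\<close> then cancels that component. The
  bound on \<open>z $ i1\<close> serves the bracketing search, the identity for \<open>D'\<close>
  the lower bound on \<open>f\<close>.\<close>

lemma state_step:
  assumes st: "state x d D q" and aw: "armijo_wolfe f c1 c2 x d t"
  defines "z \<equiv> x + t *\<^sub>R d"
  defines "d' \<equiv> - (smbfgs_matrix (z - x) (grad f z - grad f x) *v grad f z)"
  shows "\<exists>D' q'. state z d' D' q' \<and> \<bar>z $ i1\<bar> < 2 * D' \<and> 2 * a * D' = a * (t * D) - m * q * (t * D)"
proof -
  define \<sigma> where "\<sigma> = sgn (x $ i1)"
  define S where "S = t * D"
  \<comment> \<open>The first component of the new direction comes only from the term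
    \<open>s s^T\<close>, with factor \<open>(a - m * q) / (2 * a)\<close>; \<open>q'\<close> is the
    ratio of the other components to it, up to sign.\<close>
  define D' where "D' = S * (a - m * q) / (2 * a)"
  define q' where "q' = (1 - q * a + 2 * m * q\<^sup>2) / (a - m * q)"
  have x: "x $ i1 \<noteq> 0" "D > 0" "0 \<le> q" "q * a \<le> 1" using st by (auto simp: state_def)
  have t: "t > 0" "armijo f c1 x d t" "wolfe f c2 x d t"
    using aw by (auto simp: armijo_wolfe_def)
  have S: "S > 0" using t x by (simp add: S_def)
  have flip: "\<bar>x $ i1\<bar> < S" using wolfe_iff[OF st] t by (simp add: S_def)
  have \<sigma>: "\<sigma> = 1 \<or> \<sigma> = -1" using x by (auto simp: \<sigma>_def sgn_if)
  have z: "z $ i1 = \<sigma> * (\<bar>x $ i1\<bar> - S)"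
    using state_step_nth(1)[OF st] by (simp add: z_def S_def \<sigma>_def)
  have z0: "z $ i1 \<noteq> 0" and sgnz: "sgn (z $ i1) = - \<sigma>" and absz: "\<bar>z $ i1\<bar> = S - \<bar>x $ i1\<bar>"
    using flip \<sigma> by (auto simp: z sgn_mult abs_mult)
  have mq: "0 \<le> m * q" "4 * (m * q) \<le> a" using q_bound[OF x(3,4)] x card by auto
  have pos: "a - m * q > 0" using mq a by linarith
  have s: "z - x = axial_vec i1 (- (\<sigma> * S)) (- (q * S))"
    using st by (simp add: z_def state_def \<sigma>_def S_def scaleR_axial_vec mult_ac)
  have y: "grad f z - grad f x = axial_vec i1 (- (2 * a * \<sigma>)) 0"
    using x z0 sgnz by (simp add: grad_ns_fun diff_axial_vec \<sigma>_def mult.assoc)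
  have g: "grad f z = axial_vec i1 (- (a * \<sigma>)) 1"
    using z0 sgnz by (simp add: grad_ns_fun)
  define w where "w = axial_vec i1 (- (m * q * \<sigma>)) 1"
  have \<sigma>\<sigma>: "\<sigma> * \<sigma> = 1" "\<sigma> * (\<sigma> * r) = r" for r using \<sigma> by auto
  have ys: "axial_vec i1 (- (2 * a * \<sigma>)) 0 \<bullet> axial_vec i1 (- (\<sigma> * S)) (- (q * S)) = 2 * a * S"
    using \<sigma>\<sigma> by (simp add: inner mult_ac)
  have yy: "axial_vec i1 (- (2 * a * \<sigma>)) 0 \<bullet> axial_vec i1 (- (2 * a * \<sigma>)) 0 = 4 * a * a"
    using \<sigma>\<sigma> by (simp add: inner mult_ac)
  have sg: "axial_vec i1 (- (\<sigma> * S)) (- (q * S)) \<bullet> axial_vec i1 (- (a * \<sigma>)) 1 = S * (a - m * q)"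
    using \<sigma>\<sigma> by (simp add: inner algebra_simps)
  have w: "axial_vec i1 (- (a * \<sigma>)) 1 - (S * (a - m * q) / (2 * a * S)) *\<^sub>R axial_vec i1 (- (2 * a * \<sigma>)) 0 = w"
    using a S by (simp add: w_def axial_vec_arith field_simps)
  have yw: "axial_vec i1 (- (2 * a * \<sigma>)) 0 \<bullet> w = 2 * a * m * q"
    using \<sigma>\<sigma> by (simp add: inner w_def mult_ac)
  have Vw: "w - (2 * a * m * q / (2 * a * S)) *\<^sub>R axial_vec i1 (- (\<sigma> * S)) (- (q * S)) = axial_vec i1 0 (1 + m * q * q)"
    using a S by (simp add: w_def axial_vec_arith field_simps)
  have "smbfgs_matrix (z - x) (grad f z - grad f x) *v grad f z =
      (2 * a * S / (4 * a * a)) *\<^sub>R axial_vec i1 0 (1 + m * q * q)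
      + (S * (a - m * q) / (2 * a * S)) *\<^sub>R axial_vec i1 (- (\<sigma> * S)) (- (q * S))"
    unfolding y s unfolding g smbfgs_matrix_mult_vec
    by (simp only: inner_commute[of "axial_vec i1 (- (\<sigma> * S)) (- (q * S))" "axial_vec i1 (- (2 * a * \<sigma>)) 0"]
        ys yy sg w yw Vw)
  also have "\<dots> = axial_vec i1 (- (\<sigma> * D')) (S * (1 - q * a + 2 * m * q\<^sup>2) / (2 * a))"
    unfolding axial_vec_arith
    by (rule arg_cong2[of _ _ _ _ "axial_vec i1"]) (use a S in \<open>simp_all add: D'_def field_simps power2_eq_square\<close>)
  finally have "d' = axial_vec i1 (\<sigma> * D') (- (S * (1 - q * a + 2 * m * q\<^sup>2) / (2 * a)))"
    by (simp add: d'_def minus_axial_vec)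
  moreover have "S * (1 - q * a + 2 * m * q\<^sup>2) / (2 * a) = q' * D'"
    using pos by (simp add: q'_def D'_def)
  ultimately have d': "d' = axial_vec i1 (- (sgn (z $ i1) * D')) (- (q' * D'))"
    by (simp add: sgnz)
  have D': "D' > 0" using pos S a by (simp add: D'_def)
  have "1 - q * a + 2 * m * q\<^sup>2 \<ge> 0" using x card by (intro add_nonneg_nonneg) auto
  then have "q' \<ge> 0" using pos by (simp add: q'_def)
  \<comment> \<open>With the denominator cleared,
    \<open>2 * m * q\<^sup>2 * a \<le> 2 * m * q\<close> and
    \<open>4 * m * q \<le> q * a\<^sup>2\<close> bound the left side by
    \<open>a - 2 * m * q\<close>.\<close>
  have "q' * a \<le> 1"
  proof -
    have "2 * (m * q) * (q * a) \<le> 2 * (m * q) * 1"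
      using mq x by (intro mult_left_mono) auto
    moreover have "q * (4 * m) \<le> q * a\<^sup>2" using a x by (intro mult_left_mono) auto
    moreover have "0 \<le> m * q" by (rule mq)
    ultimately have "(1 - q * a + 2 * m * q\<^sup>2) * a \<le> a - m * q"
      by (simp add: algebra_simps power2_eq_square)
    then show ?thesis using pos by (simp add: q'_def divide_simps)
  qed
  \<comment> \<open>Armijo gives strict decrease, that is
    \<open>2 * a * \<bar>z $ i1\<bar> < (a + m * q) * S\<close>. Since
    \<open>3 * m * q \<le> a\<close>, half the right side is at most \<open>(a - m * q) * S\<close>,
    which is \<open>2 * a * D'\<close>.\<close>
  have "\<bar>z $ i1\<bar> < 2 * D'"
  proof -
    have "c1 * S * (a + m * q) > 0" using c S a mq by (intro mult_pos_pos) auto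
    with t(2) flip have "a * (S - \<bar>x $ i1\<bar>) - a * \<bar>x $ i1\<bar> - m * q * S < 0"
      unfolding armijo_eq[OF st] by (simp add: S_def)
    then have "2 * (a * \<bar>z $ i1\<bar>) < a * S + m * q * S"
      unfolding absz by (simp add: algebra_simps)
    moreover have "4 * (m * q) * S \<le> a * S" using mq S by (intro mult_right_mono) auto
    moreover have "0 \<le> m * q * S" using mq S by simp
    ultimately have "a * \<bar>z $ i1\<bar> < a * S - m * q * S" by linarith
    then show ?thesis using a by (simp add: D'_def field_simps)
  qed
  moreover have "2 * a * D' = a * S - m * q * S"
    using a by (simp add: D'_def field_simps)
  ultimately show ?thesis
    using d' D' z0 \<open>q' \<ge> 0\<close> \<open>q' * a \<le> 1\<close> unfolding state_def S_def by blast
qed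

section \<open>Whole runs: no termination, and the lower bound\<close>

text \<open>Keeping \<open>L\<close> general covers both line searches. Its hypothesis is confined
  to states because the bracketing search is known to give \<open>armijo_wolfe\<close> steps only
  there.\<close>

lemma run_state:
  assumes run: "smbfgs_run L f x0 K x d t" and "x0 $ i1 \<noteq> 0"
    and L: "\<And>k D q. enat k < K \<Longrightarrow> state (x k) (d k) D q \<Longrightarrow> L (x k) (d k) (t k) \<Longrightarrow>
      armijo_wolfe f c1 c2 (x k) (d k) (t k)"
  shows "enat k \<le> K \<Longrightarrow> \<exists>D q. state (x k) (d k) D q"
proof (induction k)
  case 0
  then show ?case
    using run state_init[OF assms(2)] by (auto simp: smbfgs_run_def)
next
  case (Suc k)
  then have k: "enat k < K" by (simp add: Suc_ile_eq)
  then obtain D q where st: "state (x k) (d k) D q" using Suc.IH less_imp_le by blast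
  have *: "L (x k) (d k) (t k)" "x (Suc k) = x k + t k *\<^sub>R d k"
     "d (Suc k) = - (smbfgs_matrix (x (Suc k) - x k) (grad f (x (Suc k)) - grad f (x k))
                        *v grad f (x (Suc k)))"
    using run k by (auto simp: smbfgs_run_def)
  from state_step[OF st L[OF k st *(1)]] show ?case
    unfolding * by blast
qed

text \<open>By maximality a finite run ends where \<open>L\<close> returns nothing, which never
  happens at a state.\<close>

lemma run_infinite:
  assumes "smbfgs_run L f x0 K x d t"
    and "\<And>k. enat k \<le> K \<Longrightarrow> \<exists>D q. state (x k) (d k) D q"
    and "\<And>x d D q. state x d D q \<Longrightarrow> \<exists>\<tau>. L x d \<tau>"
  shows "K = \<infinity>"
proof (cases K)
  case (enat k)
  then show ?thesis using assms unfolding smbfgs_run_def by (metis order_refl)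
qed auto

text \<open>Reading \<open>D\<close> off as \<open>\<bar>d k $ i1\<bar>\<close> states the step in
  terms of the run alone; the drop \<open>m * q * (t * D)\<close> of the tail sum cancels, and
  \<open>q\<close> disappears.\<close>

lemma run_step:
  assumes run: "smbfgs_run L f x0 \<infinity> x d t"
    and st: "\<exists>D q. state (x k) (d k) D q"
    and aw: "armijo_wolfe f c1 c2 (x k) (d k) (t k)"
  shows "\<bar>x (Suc k) $ i1\<bar> < 2 * \<bar>d (Suc k) $ i1\<bar>"
    and "tail_sum (x (Suc k)) - 2 * a * \<bar>d (Suc k) $ i1\<bar> = tail_sum (x k) - a * (t k * \<bar>d k $ i1\<bar>)"
proof -
  obtain D q where st: "state (x k) (d k) D q" using st by blast
  have *: "x (Suc k) = x k + t k *\<^sub>R d k"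
     "d (Suc k) = - (smbfgs_matrix (x (Suc k) - x k) (grad f (x (Suc k)) - grad f (x k))
                        *v grad f (x (Suc k)))"
    using run by (auto simp: smbfgs_run_def)
  have D: "\<bar>d $ i1\<bar> = D" if "state x d D q" for x d D q
    using that by (auto simp: state_def abs_mult sgn_if)
  obtain D' q' where D': "state (x (Suc k)) (d (Suc k)) D' q'" "\<bar>x (Suc k) $ i1\<bar> < 2 * D'"
    "2 * a * D' = a * (t k * D) - m * q * (t k * D)"
    using state_step[OF st aw] unfolding *[symmetric] by blast
  show "\<bar>x (Suc k) $ i1\<bar> < 2 * \<bar>d (Suc k) $ i1\<bar>"
    using D' by (simp add: D[OF D'(1)])
  show "tail_sum (x (Suc k)) - 2 * a * \<bar>d (Suc k) $ i1\<bar> = tail_sum (x k) - a * (t k * \<bar>d k $ i1\<bar>)"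
    unfolding D[OF D'(1)] D[OF st] D'(3) *(1) state_step_nth(2)[OF st] by simp
qed

lemma run_bdd_below:
  assumes run: "smbfgs_run L f x0 \<infinity> x d t"
    and st: "\<And>k. \<exists>D q. state (x k) (d k) D q"
    and aw: "\<And>k. armijo_wolfe f c1 c2 (x k) (d k) (t k)"
    and t: "\<And>k. k \<ge> 1 \<Longrightarrow> t k \<le> 2"
  shows "bdd_below (range (\<lambda>N. f (x N)))"
proof -
  define \<Phi> where "\<Phi> k = tail_sum (x k) - 2 * a * \<bar>d k $ i1\<bar>" for k
  txt \<open>The first steplength may exceed 2, so \<open>\<Phi>\<close> is monotone only from index 1 on.\<close>
  have "\<Phi> (Suc k) \<le> \<Phi> (Suc (Suc k))" for k
  proof -
    \<comment> \<open>By \<open>run_step\<close>, \<Phi> grows by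
      \<open>a * \<bar>d k $ i1\<bar> * (2 - t k)\<close> from \<open>k\<close> to
      \<open>Suc k\<close>.\<close>
    have "a * (t (Suc k) * \<bar>d (Suc k) $ i1\<bar>) \<le> a * (2 * \<bar>d (Suc k) $ i1\<bar>)"
      using a t by (intro mult_left_mono mult_right_mono) auto
    then show ?thesis
      using run_step(2)[OF run st aw, of "Suc k"] by (simp add: \<Phi>_def)
  qed
  then have mono: "\<Phi> 1 \<le> \<Phi> (Suc k)" for k
    using lift_Suc_mono_le[of "\<lambda>k. \<Phi> (Suc k)" 0 k] by simp
  have "\<Phi> k \<le> f (x k)" for k
  proof -
    have "0 \<le> a * \<bar>x k $ i1\<bar>" "0 \<le> 2 * a * \<bar>d k $ i1\<bar>" using a by auto
    then show ?thesis unfolding \<Phi>_def ns_fun_def by linarith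
  qed
  then have "min (\<Phi> 0) (\<Phi> 1) \<le> f (x k)" for k
    using mono[of "k - 1"] by (cases k) (auto simp: min_le_iff_disj intro: order_trans)
  then show ?thesis by (rule bdd_belowI2)
qed

lemma armijo_wolfe_run:
  assumes run: "smbfgs_run (armijo_wolfe f c1 c2) f x0 K x d t" and "x0 $ i1 \<noteq> 0"
    and t: "\<And>k. k \<ge> 1 \<Longrightarrow> enat k < K \<Longrightarrow> t k \<le> 2"
  shows "K = \<infinity> \<and> bdd_below (range (\<lambda>N. f (x N)))"
proof -
  have st: "\<exists>D q. state (x k) (d k) D q" if "enat k \<le> K" for k
    using run_state[OF run assms(2) _ that] by blast
  have "K = \<infinity>"
    by (rule run_infinite[OF run st armijo_wolfe_exists])
  moreover have "armijo_wolfe f c1 c2 (x k) (d k) (t k)" for k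
    using run \<open>K = \<infinity>\<close> by (simp add: smbfgs_run_def)
  ultimately show ?thesis
    using run_bdd_below[of _ x0 x d t] run st t by simp
qed

lemma bracketing_run:
  assumes run: "smbfgs_run (bracketing_search f c1 c2) f x0 K x d t" and "x0 $ i1 \<noteq> 0"
  shows "K = \<infinity> \<and> (\<forall>k. armijo_wolfe f c1 c2 (x k) (d k) (t k)) \<and> (\<forall>k\<ge>1. t k \<le> 2) \<and>
    bdd_below (range (\<lambda>N. f (x N)))"
proof -
  have st: "\<exists>D q. state (x k) (d k) D q" if "enat k \<le> K" for k
    using run_state[OF run assms(2) _ that] bracketing_search_armijo_wolfe by blast
  have K: "K = \<infinity>"
    by (rule run_infinite[OF run st bracketing_exists])
  have L: "bracketing_search f c1 c2 (x k) (d k) (t k)" for k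
    using run K by (simp add: smbfgs_run_def)
  have st: "\<exists>D q. state (x k) (d k) D q" for k using st K by simp
  have aw: "armijo_wolfe f c1 c2 (x k) (d k) (t k)" for k
    using st L bracketing_search_armijo_wolfe by blast
  have "t (Suc k) \<le> 2" for k
  proof -
    obtain D q where s: "state (x (Suc k)) (d (Suc k)) D q" using st by blast
    then have "\<bar>d (Suc k) $ i1\<bar> = D" by (auto simp: state_def abs_mult sgn_if)
    \<comment> \<open>The kink lies at steplength \<open>\<bar>x (Suc k) $ i1\<bar> / D\<close>,
      which \<open>run_step\<close> places below 2.\<close>
    then have "wolfe f c2 (x (Suc k)) (d (Suc k)) 2"
      using run_step(1)[OF run[unfolded K] st aw, of k] wolfe_iff[OF s, of 2] by simp
    with L show ?thesis by (rule bracketing_search_le_2)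
  qed
  then have t: "t k \<le> 2" if "k \<ge> 1" for k
    using that by (cases k) auto
  show ?thesis
    using K aw t run_bdd_below[OF run[unfolded K] st aw] by simp
qed

end

theorem theorem13:
  fixes a c1 c2 :: real and i1 :: "'n::finite" and x0 :: "real^'n"
  assumes "CARD('n) \<ge> 2"
    and "0 < c1" and "c1 < c2" and "c2 < 1"
    and "a \<ge> 2 * sqrt (real (CARD('n) - 1))"
    and "x0 $ i1 \<noteq> 0"
  shows
    "(\<forall>K x d t.
        smbfgs_run (armijo_wolfe (ns_fun a i1) c1 c2) (ns_fun a i1) x0 K x d t \<longrightarrow>
        (\<forall>k\<ge>1. enat k < K \<longrightarrow> t k \<le> 2) \<longrightarrow>
        K = \<infinity> \<and> bdd_below (range (\<lambda>N. ns_fun a i1 (x N)))) \<and>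
     (\<forall>K x d t.
        smbfgs_run (bracketing_search (ns_fun a i1) c1 c2) (ns_fun a i1) x0 K x d t \<longrightarrow>
        K = \<infinity> \<and>
        (\<forall>k. armijo_wolfe (ns_fun a i1) c1 c2 (x k) (d k) (t k)) \<and>
        (\<forall>k\<ge>1. t k \<le> 2) \<and>
        bdd_below (range (\<lambda>N. ns_fun a i1 (x N))))"
proof -
  have m: "real (CARD('n) - 1) \<ge> 1" using assms(1) by simp
  have "2 * sqrt (real (CARD('n) - 1)) > 0" using m by simp
  then have "a > 0" using assms(5) by linarith
  have "(2 * sqrt (real (CARD('n) - 1)))\<^sup>2 \<le> a\<^sup>2"
    using assms(5) by (intro power_mono) auto
  then have "4 * real (CARD('n) - 1) \<le> a\<^sup>2" by (simp add: power_mult_distrib)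
  then interpret smbfgs_ns a c1 c2 "real (CARD('n) - 1)" i1
    using m \<open>a > 0\<close> assms(2-4) by unfold_locales auto
  show ?thesis
    using armijo_wolfe_run[OF _ assms(6)] bracketing_run[OF _ assms(6)] by blast
qed

end
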